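(* Let $G$ be a finite simple bipartite graph with at least one edge, with bipartition $(X,Y)$, such that all vertices of $X$ have the same degree and all vertices of $Y$ have the same degree (i.e. $G$ is biregular). Then $G$ admits an antimagic orientation.
   Context: For a directed graph $D$ with $m$ arcs, an antimagic labeling is a bijection from the set of arcs of $D$ to $\{1,2,\dots,m\}$ such that the oriented vertex sums of all vertices are pairwise distinct, where the oriented vertex sum at a vertex $v$ is the sum of the labels of all arcs entering $v$ minus the sum of the labels of all arcs leaving $v$. An undirected graph $G$ admits an antimagic orientation if some orientation of $G$ has an antimagic labeling. *)

theory Defs
  imports "Graph_Theory.Graph_Theory"
begin

text \<open>
  A finite simple undirected graph is a \<^locale>\<open>pair_graph\<close>: an edge $uv$ is represented by the
  two arcs $(u,v)$ and $(v,u)$.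
\<close>

text \<open>Each edge at \<open>v\<close> contributes exactly one arc leaving \<open>v\<close>.\<close>

definition vertex_degree :: "'a pair_pre_digraph \<Rightarrow> 'a \<Rightarrow> nat" where
  "vertex_degree G v = out_degree (with_proj G) v"

definition bipartition :: "'a pair_pre_digraph \<Rightarrow> 'a set \<Rightarrow> 'a set \<Rightarrow> bool" where
  "bipartition G X Y \<longleftrightarrow>
     X \<union> Y = pverts G \<and> X \<inter> Y = {} \<and>
     (\<forall>(u, v) \<in> parcs G. u \<in> X \<and> v \<in> Y \<or> u \<in> Y \<and> v \<in> X)"

definition biregular :: "'a pair_pre_digraph \<Rightarrow> 'a set \<Rightarrow> 'a set \<Rightarrow> bool" where
  "biregular G X Y \<longleftrightarrow>
     (\<forall>x \<in> X. \<forall>x' \<in> X. vertex_degree G x = vertex_degree G x') \<and>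
     (\<forall>y \<in> Y. \<forall>y' \<in> Y. vertex_degree G y = vertex_degree G y')"

text \<open>An orientation keeps exactly one of the two arcs representing each edge.\<close>

definition orientation_of :: "'a pair_pre_digraph \<Rightarrow> 'a pair_pre_digraph \<Rightarrow> bool" where
  "orientation_of D G \<longleftrightarrow>
     pverts D = pverts G \<and> parcs D \<subseteq> parcs G \<and>
     (\<forall>(u, v) \<in> parcs G. (u, v) \<in> parcs D \<longleftrightarrow> (v, u) \<notin> parcs D)"

definition oriented_vertex_sum :: "('a, 'b) pre_digraph \<Rightarrow> ('b \<Rightarrow> nat) \<Rightarrow> 'a \<Rightarrow> int" where
  "oriented_vertex_sum D f v =
     (\<Sum>e \<in> in_arcs D v. int (f e)) - (\<Sum>e \<in> out_arcs D v. int (f e))"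

definition antimagic_labeling :: "('a, 'b) pre_digraph \<Rightarrow> ('b \<Rightarrow> nat) \<Rightarrow> bool" where
  "antimagic_labeling D f \<longleftrightarrow>
     bij_betw f (arcs D) {1..card (arcs D)} \<and>
     inj_on (oriented_vertex_sum D f) (verts D)"

definition admits_antimagic_orientation :: "'a pair_pre_digraph \<Rightarrow> bool" where
  "admits_antimagic_orientation G \<longleftrightarrow>
     (\<exists>D. orientation_of D G \<and> (\<exists>f. antimagic_labeling (with_proj D) f))"

end

theory Submission
  imports Defs
begin

text \<open>
  Orient every edge from \<open>X\<close> to \<open>Y\<close>: sums are then negative on \<open>X\<close> and positive on \<open>Y\<close>, so it
  suffices to separate vertices of the same side by their total labels. Explore the graph in
  breadth-first layers, starting from a new root whenever a component is exhausted, and give the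
  labels in increasing order from the last layer back to the first. A vertex uses
  larger labels than every vertex of its side in a later layer, and has the same degree, hence the larger
  total. Inside one layer every vertex has an edge to the previous layer; the edges chosen
  in this way are labelled last, in the order of the partial totals.
\<close>

section \<open>Comparing and separating sums of labels\<close>

lemma sum_less_of_card_eq:
  fixes f :: "'e \<Rightarrow> nat"
  assumes "finite A" "finite B" "card A = card B" "A \<noteq> {}"
    and less: "\<And>a b. a \<in> A \<Longrightarrow> b \<in> B \<Longrightarrow> f a < f b"
  shows "sum f A < sum f B"
proof -
  obtain h where h: "bij_betw h A B"
    using assms(1-3) finite_same_card_bij by blast
  have "sum f A < (\<Sum>a\<in>A. f (h a))"
    using assms(1,4) less bij_betwE[OF h] by (intro sum_strict_mono) auto
  also have "\<dots> = sum f B"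
    by (rule sum.reindex_bij_betw[OF h])
  finally show ?thesis .
qed

text \<open>Handing out increasing labels along \<open>N\<close> in nondecreasing order of
  \<open>g\<close> makes \<open>g + h\<close> strictly increasing, even across ties of
  \<open>g\<close>. The induction inserts an element with maximal \<open>g\<close>, which receives
  the top label.\<close>

lemma ex_bij_distinct_sums:
  fixes g :: "'a \<Rightarrow> nat"
  assumes "finite N"
  shows "\<exists>h. bij_betw h N {a<..a + card N} \<and> inj_on (\<lambda>v. g v + h v) N"
  using assms
proof (induction N rule: finite_ranking_induct[where f = g])
  case empty
  then show ?case by (auto simp: bij_betw_def)
next
  case (insert x N)
  then obtain h where h: "bij_betw h N {a<..a + card N}" "inj_on (\<lambda>v. g v + h v) N"
    by blast
  show ?case
  proof (cases "x \<in> N")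
    case True
    then show ?thesis using h by (auto simp: insert_absorb)
  next
    case False
    let ?h = "h(x := Suc (a + card N))"
    have le: "h v \<le> a + card N" if "v \<in> N" for v
      using bij_betwE[OF h(1)] that by auto
    have "bij_betw ?h N {a<..a + card N}"
      using h(1) False by (subst bij_betw_cong[of _ _ h]) auto
    then have "bij_betw ?h (insert x N) (insert (?h x) {a<..a + card N})"
      using notIn_Un_bij_betw[of x N ?h "{a<..a + card N}"] False by simp
    moreover have "insert (?h x) {a<..a + card N} = {a<..a + card (insert x N)}"
      using False insert.hyps by auto
    moreover have "inj_on (\<lambda>v. g v + ?h v) (insert x N)"
    proof -
      have "inj_on (\<lambda>v. g v + ?h v) N"
        using h(2) False by (subst inj_on_cong[where g = "\<lambda>v. g v + h v"]) auto
      moreover have "g v + ?h v < g x + ?h x" if "v \<in> N" for v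
        using le[OF that] insert.hyps(2)[OF that] that False by auto
      ultimately show ?thesis
        using False by (fastforce simp: inj_on_insert)
    qed
    ultimately show ?thesis by metis
  qed
qed

section \<open>The layered exploration and its invariant\<close>

text \<open>The two colours stand for the sides \<open>X\<close> and \<open>Y\<close>. Edges are
  abstract objects with a set of ends, so that arcs can later serve as undirected edges.\<close>

locale biregular_bicoloured_graph =
  fixes V :: "'a set" and E :: "'e set" and ends :: "'e \<Rightarrow> 'a set" and col :: "'a \<Rightarrow> bool"
    and inc :: "'a \<Rightarrow> 'e set"
  assumes inc_def: "inc v = {e \<in> E. v \<in> ends e}"
    and finite_V: "finite V" and finite_E: "finite E"
    and ends_subset: "e \<in> E \<Longrightarrow> ends e \<subseteq> V"
    and ends_col: "e \<in> E \<Longrightarrow> \<exists>u v. ends e = {u, v} \<and> col u \<noteq> col v"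
    and card_inc: "u \<in> V \<Longrightarrow> v \<in> V \<Longrightarrow> col u = col v \<Longrightarrow> card (inc u) = card (inc v)"
    and inc_nonempty: "v \<in> V \<Longrightarrow> inc v \<noteq> {}"
begin

text \<open>\<open>S\<close> is the set of vertices explored so far. Labels are given from the last
  layer backwards, so these edges are labelled before those inside \<open>S\<close>.\<close>

definition outer :: "'a set \<Rightarrow> 'e set" where
  "outer S = {e \<in> E. \<not> ends e \<subseteq> S}"

text \<open>The invariant of the backward labelling: the outer edges use up the smallest labels. The
  last clause prepares the moment when a vertex \<open>v\<close> of \<open>S\<close> becomes an
  outside vertex: its outer edges already beat every edge at the later vertices of its colour, and
  its remaining edges will get larger labels still.\<close>

definition good_labeling :: "'a set \<Rightarrow> ('e \<Rightarrow> nat) \<Rightarrow> bool" where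
  "good_labeling S f \<longleftrightarrow>
     bij_betw f (outer S) {0<..card (outer S)} \<and>
     (\<forall>u \<in> V - S. \<forall>v \<in> V - S. u \<noteq> v \<longrightarrow> col u = col v \<longrightarrow> sum f (inc u) \<noteq> sum f (inc v)) \<and>
     (\<forall>v \<in> S. \<forall>u \<in> V - S. col u = col v \<longrightarrow>
        (\<forall>e \<in> inc v \<inter> outer S. \<forall>e' \<in> inc u. f e' < f e))"

lemma finite_inc: "finite (inc v)"
  unfolding inc_def using finite_E by simp

lemma inc_outer: "v \<notin> S \<Longrightarrow> inc v \<subseteq> outer S"
  unfolding inc_def outer_def by auto

lemma sum_inc_less:
  fixes f :: "'e \<Rightarrow> nat"
  assumes "u \<in> V" "v \<in> V" "col u = col v"
    and "\<And>e e'. e \<in> inc v \<Longrightarrow> e' \<in> inc u \<Longrightarrow> f e' < f e"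
  shows "sum f (inc u) < sum f (inc v)"
  using assms by (intro sum_less_of_card_eq finite_inc card_inc inc_nonempty) auto

section \<open>One backward step: removing a root or a layer from the explored set\<close>

text \<open>When \<open>S\<close> is a union of components, adding a single vertex encloses no edge,
  so the labelling can stay as it is. All edges at \<open>r\<close> are outer, hence the last clause
  of the invariant puts the sum at \<open>r\<close> above all others of its colour. For
  \<open>S\<close> itself that clause is vacuous, as no outer edge meets \<open>S\<close>.\<close>

lemma good_labeling_new_root:
  assumes S: "S \<subseteq> V" and r: "r \<in> V - S"
    and closed: "\<And>e. e \<in> E \<Longrightarrow> ends e \<inter> S \<noteq> {} \<Longrightarrow> ends e \<subseteq> S"
    and f: "good_labeling (insert r S) f"
  shows "good_labeling S f"
proof -
  have outer_eq: "outer S = outer (insert r S)"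
  proof
    show "outer S \<subseteq> outer (insert r S)"
    proof
      fix e assume e: "e \<in> outer S"
      then have "e \<in> E" by (simp add: outer_def)
      then obtain u v where uv: "ends e = {u, v}" "col u \<noteq> col v"
        using ends_col by blast
      then have "u \<notin> S" "v \<notin> S" "u \<noteq> v"
        using closed e by (auto simp: outer_def)
      then show "e \<in> outer (insert r S)"
        using uv \<open>e \<in> E\<close> by (auto simp: outer_def)
    qed
  qed (auto simp: outer_def)
  have empty: "inc v \<inter> outer S = {}" if "v \<in> S" for v
    using closed that by (auto simp: inc_def outer_def)
  have root: "sum f (inc u) < sum f (inc r)" if "u \<in> V - insert r S" "col u = col r" for u
  proof (rule sum_inc_less)
    fix e e' assume "e \<in> inc r" "e' \<in> inc u"
    moreover have "e \<in> outer (insert r S)"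
      using inc_outer[of r S] r outer_eq \<open>e \<in> inc r\<close> by auto
    ultimately show "f e' < f e"
      using f that unfolding good_labeling_def by auto
  qed (use that r in auto)
  have "sum f (inc u) \<noteq> sum f (inc v)"
    if "u \<in> V - S" "v \<in> V - S" "u \<noteq> v" "col u = col v" for u v
  proof (cases "u = r \<or> v = r")
    case True
    then show ?thesis using root[of u] root[of v] that by auto
  next
    case False
    then show ?thesis using f that unfolding good_labeling_def by blast
  qed
  then show ?thesis
    using f empty unfolding good_labeling_def outer_eq[symmetric] by blast
qed

text \<open>\<open>N\<close> is the next layer. Since the boundary of \<open>S\<close> has the
  single colour \<open>b\<close>, \<open>N\<close> has the opposite colour, so the newly enclosed
  edges \<open>B\<close> all join \<open>S\<close> to \<open>N\<close>. They take the labels just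
  above \<open>?m\<close>, with one chosen edge per vertex of \<open>N\<close> kept for the end to
  separate the sums inside \<open>N\<close>.\<close>

lemma good_labeling_new_layer:
  assumes S: "S \<subseteq> V"
    and N_def: "N = {v \<in> V - S. \<exists>e \<in> inc v. ends e \<inter> S \<noteq> {}}"
    and boundary: "\<And>e u. e \<in> outer S \<Longrightarrow> u \<in> ends e \<Longrightarrow> u \<in> S \<Longrightarrow> col u = b"
    and f: "good_labeling (S \<union> N) f"
  shows "\<exists>f'. good_labeling S f'"
proof -
  define B where "B = outer S - outer (S \<union> N)"
  let ?m = "card (outer (S \<union> N))"
  have fin: "finite (outer T)" for T
    using finite_E by (simp add: outer_def)
  have finN: "finite N"
    using finite_V by (simp add: N_def)
  have finB: "finite B" using fin by (simp add: B_def)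
  have outer_Un: "outer S = outer (S \<union> N) \<union> B"
    by (auto simp: B_def outer_def)
  have disj: "outer (S \<union> N) \<inter> B = {}"
    by (auto simp: B_def)
  have colN: "col v \<longleftrightarrow> \<not> b" if "v \<in> N" for v
  proof -
    from that obtain e u where e: "e \<in> E" "v \<in> ends e" "u \<in> ends e" "u \<in> S" "v \<notin> S"
      by (auto simp: N_def inc_def)
    then have "col u = b" using boundary[of e u] by (auto simp: outer_def)
    moreover obtain a c where "ends e = {a, c}" "col a \<noteq> col c"
      using ends_col[OF \<open>e \<in> E\<close>] by blast
    ultimately show ?thesis using e by auto
  qed
  \<comment> \<open>An edge has only two ends, so one that leaves \<open>S\<close> has its other end
    in \<open>N\<close> and is enclosed by \<open>S \<union> N\<close>.\<close>
  have crossing: "e \<in> B" if "e \<in> E" "u \<in> ends e" "u \<in> S" "v \<in> ends e" "v \<notin> S" for e u v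
  proof -
    obtain a c where "ends e = {a, c}" "col a \<noteq> col c"
      using ends_col[OF \<open>e \<in> E\<close>] by blast
    moreover have "v \<in> N"
      using that ends_subset[of e] by (auto simp: N_def inc_def)
    ultimately have "ends e \<subseteq> S \<union> N" using that by auto
    then show ?thesis using that by (auto simp: B_def outer_def)
  qed
  have B_ends: "\<exists>u v. ends e = {u, v} \<and> u \<in> S \<and> v \<in> N" if "e \<in> B" for e
  proof -
    have e: "e \<in> E" "ends e \<subseteq> S \<union> N" "\<not> ends e \<subseteq> S"
      using that by (auto simp: B_def outer_def)
    obtain a c where "ends e = {a, c}" "col a \<noteq> col c"
      using ends_col[OF \<open>e \<in> E\<close>] by blast
    then have "a \<in> S \<and> c \<in> N \<or> c \<in> S \<and> a \<in> N"
      using e colN[of a] colN[of c] by auto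
    then show ?thesis
      using \<open>ends e = {a, c}\<close> by (metis insert_commute)
  qed
  have N_S: "N \<inter> S = {}" by (auto simp: N_def)
  have "\<exists>e. e \<in> B \<and> e \<in> inc v" if v: "v \<in> N" for v
  proof -
    obtain e u where e: "e \<in> E" "v \<in> ends e" "u \<in> ends e" "u \<in> S" "v \<notin> S"
      using v by (auto simp: N_def inc_def)
    then have "e \<in> B" using crossing[of e u v] by blast
    then show ?thesis using e by (auto simp: inc_def)
  qed
  then obtain p where p: "\<And>v. v \<in> N \<Longrightarrow> p v \<in> B \<and> p v \<in> inc v"
    by metis
  \<comment> \<open>An edge of \<open>B\<close> has exactly one end in \<open>N\<close>. Hence no
    edge is chosen twice, and \<open>p v\<close> is the only chosen edge at
    \<open>v\<close>.\<close>
  have p_unique: "u = v" if "v \<in> N" "u \<in> N" "p u \<in> inc v" for u v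
    using B_ends[of "p u"] p[of u] that N_S by (auto simp: inc_def)
  then have inj_p: "inj_on p N"
    using p by (auto intro!: inj_onI)
  define Q where "Q = B - p ` N"
  have finQ: "finite Q" using finB by (simp add: Q_def)
  have B_eq: "B = Q \<union> p ` N" using p by (auto simp: Q_def)
  obtain q where q: "bij_betw q Q {?m<..?m + card Q}"
    using finite_same_card_bij[of Q "{?m<..?m + card Q}"] finQ by auto
  \<comment> \<open>The order of labels within \<open>Q\<close> is arbitrary. After it is fixed,
    \<open>g v\<close> is the final total at \<open>v\<close> of all edges but
    \<open>p v\<close>.\<close>
  define f1 where "f1 e = (if e \<in> Q then q e else f e)" for e
  define g where "g v = sum f1 (inc v - {p v})" for v
  obtain h where h: "bij_betw h N {?m + card Q<..?m + card Q + card N}"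
    and h_inj: "inj_on (\<lambda>v. g v + h v) N"
    using ex_bij_distinct_sums[OF finN] by blast
  define f' where "f' e = (if e \<in> p ` N then h (inv_into N p e) else f1 e)" for e
  have f'_p: "f' (p v) = h v" if "v \<in> N" for v
    using that inj_p by (simp add: f'_def)
  have f'_old: "f' e = f e" if "e \<in> outer (S \<union> N)" for e
    using that disj B_eq by (auto simp: f'_def f1_def)
  have fbij: "bij_betw f (outer (S \<union> N)) {0<..?m}"
    using f by (simp add: good_labeling_def)
  have bij_old: "bij_betw f' (outer (S \<union> N)) {0<..?m}"
    using fbij by (subst bij_betw_cong[OF f'_old]) auto
  have bij_Q: "bij_betw f' Q {?m<..?m + card Q}"
    using q by (subst bij_betw_cong[of _ _ q]) (auto simp: f'_def f1_def Q_def)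
  have bij_p: "bij_betw f' (p ` N) {?m + card Q<..?m + card Q + card N}"
  proof -
    have "bij_betw (f' \<circ> p) N {?m + card Q<..?m + card Q + card N}"
      using h by (subst bij_betw_cong[of _ _ h]) (auto simp: f'_p)
    then show ?thesis
      using bij_betw_comp_iff[OF inj_on_imp_bij_betw[OF inj_p]] by blast
  qed
  have bij_B: "bij_betw f' B {?m<..?m + card Q + card N}"
  proof -
    have ran: "{?m<..?m + card Q + card N} =
        {?m<..?m + card Q} \<union> {?m + card Q<..?m + card Q + card N}" by auto
    have "{?m<..?m + card Q} \<inter> {?m + card Q<..?m + card Q + card N} = {}" by auto
    from bij_betw_combine[OF bij_Q bij_p this] show ?thesis
      unfolding ran B_eq[symmetric] .
  qed
  have card_B: "card B = card Q + card N"
    using bij_betw_same_card[OF bij_B] by simp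
  have bij: "bij_betw f' (outer S) {0<..card (outer S)}"
  proof -
    have "card (outer S) = ?m + card Q + card N"
      unfolding outer_Un using card_B card_Un_disjoint[OF fin finB disj] by simp
    then have ran: "{0<..card (outer S)} = {0<..?m} \<union> {?m<..?m + card Q + card N}" by auto
    have "{0<..?m} \<inter> {?m<..?m + card Q + card N} = {}" by auto
    from bij_betw_combine[OF bij_old bij_B this] show ?thesis
      unfolding ran outer_Un[symmetric] .
  qed
  have old_less_new: "f' e' < f' e" if "e \<in> B" "e' \<in> outer (S \<union> N)" for e e'
    using bij_betwE[OF bij_B] bij_betwE[OF bij_old] that by fastforce
  have inc_old: "inc u \<subseteq> outer (S \<union> N)" if "u \<in> V - (S \<union> N)" for u
    using that by (intro inc_outer) auto
  have sum_old: "sum f' (inc u) = sum f (inc u)" if "u \<in> V - (S \<union> N)" for u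
    using inc_old[OF that] f'_old by (intro sum.cong) auto
  \<comment> \<open>Every edge at \<open>v\<close> beats every edge at \<open>u\<close>: those in
    \<open>B\<close> are newer, and for the others this is the last clause of the invariant for
    \<open>S \<union> N\<close>.\<close>
  have less: "sum f' (inc u) < sum f' (inc v)"
    if "u \<in> V - (S \<union> N)" "v \<in> N" "col u = col v" for u v
  proof (rule sum_inc_less)
    fix e e' assume e: "e \<in> inc v" "e' \<in> inc u"
    have "e \<in> outer S"
      using inc_outer[of v S] that N_S e by auto
    then consider "e \<in> B" | "e \<in> outer (S \<union> N)"
      using outer_Un by auto
    then show "f' e' < f' e"
    proof cases
      case 1
      then show ?thesis using old_less_new inc_old e that by blast
    next
      case 2
      then have "f e' < f e"
        using f e that unfolding good_labeling_def by blast
      then show ?thesis using 2 inc_old[of u] e that f'_old by auto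
    qed
  qed (use that in \<open>auto simp: N_def\<close>)
  have sum_N: "sum f' (inc v) = g v + h v" if "v \<in> N" for v
  proof -
    have "sum f' (inc v) = f' (p v) + sum f' (inc v - {p v})"
      using p[OF that] by (intro sum.remove) (auto simp: finite_inc)
    moreover have "sum f' (inc v - {p v}) = g v"
      unfolding g_def
      using p_unique[OF that] by (intro sum.cong) (auto simp: f'_def)
    ultimately show ?thesis using f'_p[OF that] by simp
  qed
  have "sum f' (inc u) \<noteq> sum f' (inc v)"
    if uv: "u \<in> V - S" "v \<in> V - S" "u \<noteq> v" "col u = col v" for u v
  proof -
    consider "u \<in> N" "v \<in> N" | "u \<in> N" "v \<notin> N" | "u \<notin> N" "v \<in> N" | "u \<notin> N" "v \<notin> N"
      by blast
    then show ?thesis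
    proof cases
      case 1
      then show ?thesis using h_inj uv(3) by (auto simp: sum_N inj_on_def)
    next
      case 2
      then show ?thesis using less[of v u] uv by auto
    next
      case 3
      then show ?thesis using less[of u v] uv by auto
    next
      case 4
      then have "sum f (inc u) \<noteq> sum f (inc v)"
        using f uv unfolding good_labeling_def by blast
      then show ?thesis using 4 uv sum_old[of u] sum_old[of v] by simp
    qed
  qed
  \<comment> \<open>A vertex of \<open>S\<close> with an outer edge has colour \<open>b\<close>, so
    \<open>u\<close> cannot lie in \<open>N\<close>. All edges at \<open>u\<close> are therefore
    old, while \<open>e\<close> crosses from \<open>S\<close> to \<open>N\<close> and is
    new.\<close>
  moreover have "f' e' < f' e"
    if "v \<in> S" "u \<in> V - S" "col u = col v" "e \<in> inc v \<inter> outer S" "e' \<in> inc u" for u v e e'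
  proof (rule old_less_new)
    have "col v = b" using boundary[of e v] that by (auto simp: inc_def)
    then have "u \<notin> N" using colN that by auto
    then show "e' \<in> outer (S \<union> N)" using inc_old[of u] that by auto
    show "e \<in> B"
      using that crossing[of e v] by (auto simp: inc_def outer_def)
  qed
  ultimately have "good_labeling S f'"
    using bij unfolding good_labeling_def by blast
  then show ?thesis by blast
qed

section \<open>Induction over the exploration\<close>

text \<open>The induction enlarges \<open>S\<close> until nothing is left outside, where there is no
  edge to label, and the two step lemmas carry the labelling back. The one-coloured boundary is
  maintained along the way, with \<open>b\<close> alternating from layer to layer.\<close>

lemma ex_good_labeling:
  assumes "S \<subseteq> V"
    and "\<And>e u. e \<in> outer S \<Longrightarrow> u \<in> ends e \<Longrightarrow> u \<in> S \<Longrightarrow> col u = b"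
  shows "\<exists>f. good_labeling S f"
  using assms
proof (induction "card (V - S)" arbitrary: S b rule: less_induct)
  case less
  define N where "N = {v \<in> V - S. \<exists>e \<in> inc v. ends e \<inter> S \<noteq> {}}"
  show ?case
  proof (cases "S = V")
    case True
    then have "outer S = {}" using ends_subset by (auto simp: outer_def)
    then have "good_labeling S f" for f
      using True by (simp add: good_labeling_def bij_betw_def)
    then show ?thesis by blast
  next
    case False
    show ?thesis
    proof (cases "N = {}")
      case True
      obtain r where r: "r \<in> V - S" using False less.prems(1) by blast
      have closed: "ends e \<subseteq> S" if "e \<in> E" "ends e \<inter> S \<noteq> {}" for e
      proof
        fix v assume "v \<in> ends e"
        then show "v \<in> S" using that True ends_subset[of e] by (auto simp: N_def inc_def)
      qed
      have "\<exists>f. good_labeling (insert r S) f"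
      proof (rule less.hyps)
        show "card (V - insert r S) < card (V - S)"
          using r finite_V by (intro psubset_card_mono) auto
        show "insert r S \<subseteq> V" using r less.prems by auto
        \<comment> \<open>\<open>S\<close> is closed, so only \<open>r\<close> can still have an
          outer edge.\<close>
        show "col u = col r" if "e \<in> outer (insert r S)" "u \<in> ends e" "u \<in> insert r S" for e u
          using that closed[of e] by (auto simp: outer_def)
      qed
      then show ?thesis
        using good_labeling_new_root[OF less.prems(1) r closed] by blast
    next
      case N: False
      have NV: "N \<subseteq> V - S" by (auto simp: N_def)
      have "\<exists>f. good_labeling (S \<union> N) f"
      proof (rule less.hyps)
        show "card (V - (S \<union> N)) < card (V - S)"
          using N NV finite_V by (intro psubset_card_mono) auto
        show "S \<union> N \<subseteq> V" using NV less.prems by auto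
        \<comment> \<open>All neighbours of \<open>S\<close> lie in \<open>S \<union> N\<close>, so
          the new boundary is inside \<open>N\<close>, opposite in colour to the old one.\<close>
        show "col u = (\<not> b)" if e: "e \<in> outer (S \<union> N)" "u \<in> ends e" "u \<in> S \<union> N" for e u
        proof -
          have "u \<notin> S"
            using e ends_subset[of e] by (auto simp: outer_def N_def inc_def)
          then obtain e' w where e': "e' \<in> E" "u \<in> ends e'" "w \<in> ends e'" "w \<in> S"
            using e by (auto simp: N_def inc_def)
          then have "col w = b"
            using less.prems(2)[of e' w] \<open>u \<notin> S\<close> by (auto simp: outer_def)
          moreover obtain a c where "ends e' = {a, c}" "col a \<noteq> col c"
            using ends_col[OF e'(1)] by blast
          ultimately show ?thesis using e' \<open>u \<notin> S\<close> by auto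
        qed
      qed
      then obtain f where "good_labeling (S \<union> N) f" ..
      then show ?thesis
        using less.prems(2) by (intro good_labeling_new_layer[OF less.prems(1) N_def, of b])
    qed
  qed
qed

lemma ex_labeling:
  "\<exists>f. bij_betw f E {1..card E} \<and>
    (\<forall>u \<in> V. \<forall>v \<in> V. u \<noteq> v \<longrightarrow> col u = col v \<longrightarrow> sum f (inc u) \<noteq> sum f (inc v))"
proof -
  obtain f where f: "good_labeling {} f"
    using ex_good_labeling[of "{}"] by auto
  have "outer {} = E"
    using ends_col by (fastforce simp: outer_def)
  moreover have "{0<..n} = {1..n}" for n :: nat by auto
  ultimately show ?thesis
    using f unfolding good_labeling_def by auto
qed

end

section \<open>Transfer to the orientation from \<open>X\<close> to \<open>Y\<close>\<close>

theorem theorem1: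
  fixes G :: "'a pair_pre_digraph"
    and X Y :: "'a set"
  assumes "pair_graph G"
    and "parcs G \<noteq> {}"
    and "bipartition G X Y"
    and "biregular G X Y"
  shows "admits_antimagic_orientation G"
proof -
  interpret pair_graph G by fact
  \<comment> \<open>Each edge has exactly one arc in \<open>?E\<close>, so \<open>?E\<close> serves
    both as the undirected edge set for the labelling and as the arc set of the orientation.\<close>
  let ?E = "parcs G \<inter> X \<times> Y"
  let ?D = "\<lparr>pverts = pverts G, parcs = ?E\<rparr>"
  define inc where "inc v = {e \<in> ?E. v \<in> {fst e, snd e}}" for v
  have XY: "X \<union> Y = pverts G" "X \<inter> Y = {}"
    and arc_cases: "\<And>u v. (u, v) \<in> parcs G \<Longrightarrow> u \<in> X \<and> v \<in> Y \<or> u \<in> Y \<and> v \<in> X"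
    using assms(3) by (auto simp: bipartition_def)
  have sym: "(v, u) \<in> parcs G" if "(u, v) \<in> parcs G" for u v
    using that by (rule arcs_symmetric)
  have inc_X: "inc v = out_arcs (with_proj G) v" if "v \<in> X" for v
    using that XY arc_cases by (fastforce simp: inc_def out_arcs_def)
  \<comment> \<open>At a vertex of \<open>Y\<close> the arcs of \<open>?E\<close> enter, whereas the
    degree counts leaving arcs; reversal matches the two.\<close>
  have inc_Y: "inc v = prod.swap ` out_arcs (with_proj G) v" if "v \<in> Y" for v
  proof -
    have "(u, v) \<in> inc v \<longleftrightarrow> (v, u) \<in> parcs G" for u
      using that XY arc_cases sym by (fastforce simp: inc_def)
    moreover have "snd e = v" if "e \<in> inc v" for e
      using that \<open>v \<in> Y\<close> XY by (auto simp: inc_def)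
    ultimately show ?thesis
      by (force simp: out_arcs_def image_iff)
  qed
  have degree: "card (inc v) = vertex_degree G v" if "v \<in> pverts G" for v
    using that inc_X[of v] inc_Y[of v]
    by (auto simp: XY(1)[symmetric] vertex_degree_def out_degree_def card_image)
  obtain x y where xy: "(x, y) \<in> parcs G" "x \<in> X" "y \<in> Y"
  proof -
    obtain u v where "(u, v) \<in> parcs G" using assms(2) by auto
    then show thesis using that[of u v] that[of v u] arc_cases[of u v] sym[of u v] by blast
  qed
  have card_inc: "card (inc u) = card (inc v)"
    if "u \<in> pverts G" "v \<in> pverts G" "(u \<in> X) = (v \<in> X)" for u v
  proof -
    have "u \<in> X \<and> v \<in> X \<or> u \<in> Y \<and> v \<in> Y"
      using that XY by blast
    then have "vertex_degree G u = vertex_degree G v"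
      using assms(4) unfolding biregular_def by blast
    then show ?thesis using that by (simp add: degree)
  qed
  have finE: "finite ?E" by simp
  \<comment> \<open>The arc \<open>(x, y)\<close> shows a positive degree on each side, and
    biregularity spreads it to all vertices.\<close>
  have inc_nonempty: "inc v \<noteq> {}" if v: "v \<in> pverts G" for v
  proof -
    have "(x, y) \<in> inc x" "(x, y) \<in> inc y" using xy by (auto simp: inc_def)
    then have "card (inc x) \<noteq> 0" "card (inc y) \<noteq> 0"
      using finE by (auto simp: inc_def)
    moreover have "card (inc v) = card (inc x) \<or> card (inc v) = card (inc y)"
      using card_inc[OF v, of x] card_inc[OF v, of y] xy XY by blast
    ultimately show ?thesis by auto
  qed
  interpret B: biregular_bicoloured_graph "pverts G" ?E "\<lambda>e. {fst e, snd e}" "\<lambda>v. v \<in> X" inc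
  proof unfold_locales
    show "\<exists>u v. {fst e, snd e} = {u, v} \<and> (u \<in> X) \<noteq> (v \<in> X)" if "e \<in> ?E" for e
      using that XY(2) by (intro exI[of _ "fst e"] exI[of _ "snd e"]) auto
    show "{fst e, snd e} \<subseteq> pverts G" if "e \<in> ?E" for e
      using that XY(1) by auto
    show "card (inc u) = card (inc v)"
      if "u \<in> pverts G" "v \<in> pverts G" "(u \<in> X) = (v \<in> X)" for u v
      using that by (rule card_inc)
    show "inc v \<noteq> {}" if "v \<in> pverts G" for v
      using that by (rule inc_nonempty)
  qed (simp_all add: inc_def)
  obtain f where f: "bij_betw f ?E {1..card ?E}"
    and distinct: "\<And>u v. u \<in> pverts G \<Longrightarrow> v \<in> pverts G \<Longrightarrow> u \<noteq> v \<Longrightarrow> (u \<in> X) = (v \<in> X) \<Longrightarrow>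
      sum f (inc u) \<noteq> sum f (inc v)"
    using B.ex_labeling by blast
  \<comment> \<open>Labels start at 1 and no vertex is isolated. Strict positivity is what keeps the
    negative sums on \<open>X\<close> apart from the positive ones on \<open>Y\<close>.\<close>
  have pos: "sum f (inc v) > 0" if v: "v \<in> pverts G" for v
  proof -
    obtain e where "e \<in> inc v" using inc_nonempty[OF v] by blast
    then have "e \<in> ?E" by (simp add: inc_def)
    with bij_betwE[OF f] have "f e \<in> {1..card ?E}" by (rule bspec)
    then show ?thesis
      using \<open>e \<in> inc v\<close> by (intro sum_pos2[of _ e]) (auto simp: B.finite_inc)
  qed
  have sum_X: "oriented_vertex_sum (with_proj ?D) f v = - int (sum f (inc v))" if "v \<in> X" for v
  proof -
    have "in_arcs (with_proj ?D) v = {}" "out_arcs (with_proj ?D) v = inc v"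
      using that XY by (auto simp: in_arcs_def out_arcs_def inc_def)
    then show ?thesis by (simp add: oriented_vertex_sum_def)
  qed
  have sum_Y: "oriented_vertex_sum (with_proj ?D) f v = int (sum f (inc v))" if "v \<in> Y" for v
  proof -
    have "in_arcs (with_proj ?D) v = inc v" "out_arcs (with_proj ?D) v = {}"
      using that XY by (auto simp: in_arcs_def out_arcs_def inc_def)
    then show ?thesis by (simp add: oriented_vertex_sum_def)
  qed
  have "inj_on (oriented_vertex_sum (with_proj ?D) f) (pverts G)"
  proof (rule inj_onI, rule ccontr)
    fix u v
    assume uv: "u \<in> pverts G" "v \<in> pverts G" "u \<noteq> v"
      and eq: "oriented_vertex_sum (with_proj ?D) f u = oriented_vertex_sum (with_proj ?D) f v"
    have "u \<in> X \<and> v \<in> X \<or> u \<in> X \<and> v \<in> Y \<or> u \<in> Y \<and> v \<in> X \<or> u \<in> Y \<and> v \<in> Y"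
      using uv XY by blast
    then show False
      using eq distinct[OF uv] pos[OF uv(1)] pos[OF uv(2)] XY(2)
      by (elim disjE) (auto simp: sum_X sum_Y simp del: of_nat_sum)
  qed
  then have "antimagic_labeling (with_proj ?D) f"
    using f by (simp add: antimagic_labeling_def)
  moreover have "orientation_of ?D G"
    using XY arc_cases sym by (fastforce simp: orientation_of_def)
  ultimately show ?thesis
    unfolding admits_antimagic_orientation_def by blast
qed

end
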